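(* Let $\mathbf{c}=1234567891011121314\cdots$ be the Champernowne word, i.e. the infinite word over $\{0,1,\dots,9\}$ obtained by concatenating in order the base $10$ representations of the consecutive integers $1,2,3,\dots$. Then $\mathbf{Rdio}(\mathbf{c})=\mathbf{Dio}(\mathbf{c})=1$.
   Context: Infinite words are indexed from $0$: $\mathbf{a}=a_0a_1a_2\cdots$. For integers $0\le r\le s$, $\mathbf{a}[r,s]$ denotes the finite word $a_ra_{r+1}\cdots a_s$. Diophantine exponent: $\mathbf{Dio}(\mathbf{a})$ is the supremum of the real numbers $\rho$ for which there exist three sequences of integers $(r_n)_{n\ge0}$, $(s_n)_{n\ge0}$, $(t_n)_{n\ge0}$ such that, for all $n\ge 0$, $-1\le r_n<s_n<t_n$, the words $\mathbf{a}[r_n+1,r_n+t_n-s_n]$ and $\mathbf{a}[s_n+1,t_n]$ coincide, $t_n\ge\rho s_n$, and moreover $s_n-r_n\to\infty$ as $n\to\infty$. $(\epsilon,\delta)$-closeness: for two finite words $U=u_1\cdots u_L$ and $V=v_1\cdots v_L$ of the same length $L>0$, a real $\epsilon>0$ and an integer $\delta\ge 0$, $U$ and $V$ are $(\epsilon,\delta)$-close if there exist $\delta$ (possibly empty) subintervals $I_1,\dots,I_\delta$ of $\{1,\dots,L\}$ such that $\{1\le i\le L: u_i\ne v_i\}\subseteq \bigcup_{j=1}^{\delta} I_j$ and $\left|\bigcup_{j=1}^{\delta} I_j\right|\le \epsilon L$. Refined Diophantine exponent: for a real $\rho\ge 1$, $\mathbf{a}$ satisfies Condition $( * )_\rho$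 if for every $\epsilon>0$ there exist three sequences of integers $(r_n)_{n\ge0}$, $(s_n)_{n\ge0}$, $(t_n)_{n\ge0}$ and an integer $\delta\ge0$ such that: $-1\le r_n<s_n<t_n$ for all $n$; $t_n\ge\rho s_n$ for all $n$; $s_n-r_n\to\infty$ as $n\to\infty$; and for all $n$ large enough, $\mathbf{a}[r_n+1,r_n+t_n-s_n]$ and $\mathbf{a}[s_n+1,t_n]$ are $(\epsilon,\delta)$-close. The refined Diophantine exponent $\mathbf{Rdio}(\mathbf{a})\in[1,\infty]$ is the supremum of the $\rho$ for which $\mathbf{a}$ satisfies $( * )_\rho$. *)

theory Defs
  imports Complex_Main "HOL-Library.Extended_Real" "HOL-Library.Stream"
begin

text \<open>
  Infinite words are functions on \<^typ>\<open>nat\<close>. Factors are taken at integer positions, since the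
  sequence \<open>r\<close> below may take the value \<open>-1\<close>; \<open>factor a i j\<close> is only used with \<open>0 \<le> i\<close>.
\<close>

definition factor :: "(nat \<Rightarrow> 'a) \<Rightarrow> int \<Rightarrow> int \<Rightarrow> 'a list" where
  "factor a i j = map (\<lambda>k. a (nat k)) [i..j]"

definition dio_cond :: "(nat \<Rightarrow> 'a) \<Rightarrow> real \<Rightarrow> bool" where
  "dio_cond a \<rho> \<longleftrightarrow> (\<exists>r s t :: nat \<Rightarrow> int.
     (\<forall>n. -1 \<le> r n \<and> r n < s n \<and> s n < t n \<and>
          factor a (r n + 1) (r n + t n - s n) = factor a (s n + 1) (t n) \<and>
          of_int (t n) \<ge> \<rho> * of_int (s n)) \<and>
     filterlim (\<lambda>n. s n - r n) at_top sequentially)"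

definition Dio :: "(nat \<Rightarrow> 'a) \<Rightarrow> ereal" where
  "Dio a = (SUP \<rho>\<in>{\<rho>. dio_cond a \<rho>}. ereal \<rho>)"

text \<open>Positions in finite words are counted from 1, while list indices start at 0.\<close>

definition close_words :: "real \<Rightarrow> nat \<Rightarrow> 'a list \<Rightarrow> 'a list \<Rightarrow> bool" where
  "close_words \<epsilon> \<delta> U V \<longleftrightarrow> length U = length V \<and> 0 < length U \<and>
     (\<exists>I :: nat \<Rightarrow> nat set.
        (\<forall>j\<in>{1..\<delta>}. (\<exists>p q. I j = {p..q}) \<and> I j \<subseteq> {1..length U}) \<and>
        {i \<in> {1..length U}. U ! (i - 1) \<noteq> V ! (i - 1)} \<subseteq> (\<Union>j\<in>{1..\<delta>}. I j) \<and>
        real (card (\<Union>j\<in>{1..\<delta>}. I j)) \<le> \<epsilon> * real (length U))"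

definition rdio_cond :: "(nat \<Rightarrow> 'a) \<Rightarrow> real \<Rightarrow> bool" where
  "rdio_cond a \<rho> \<longleftrightarrow> (\<forall>\<epsilon>>0. \<exists>(r :: nat \<Rightarrow> int) (s :: nat \<Rightarrow> int) (t :: nat \<Rightarrow> int) (\<delta> :: nat).
     (\<forall>n. -1 \<le> r n \<and> r n < s n \<and> s n < t n) \<and>
     (\<forall>n. of_int (t n) \<ge> \<rho> * of_int (s n)) \<and>
     filterlim (\<lambda>n. s n - r n) at_top sequentially \<and>
     (\<forall>\<^sub>F n in sequentially.
        close_words \<epsilon> \<delta> (factor a (r n + 1) (r n + t n - s n)) (factor a (s n + 1) (t n))))"

definition Rdio :: "(nat \<Rightarrow> 'a) \<Rightarrow> ereal" where
  "Rdio a = (SUP \<rho>\<in>{\<rho>. \<rho> \<ge> 1 \<and> rdio_cond a \<rho>}. ereal \<rho>)"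

text \<open>Decimal digits, most significant first.\<close>

fun decimal_digits :: "nat \<Rightarrow> nat list" where
  "decimal_digits n = (if n < 10 then [n] else decimal_digits (n div 10) @ [n mod 10])"

declare decimal_digits.simps [simp del]

definition champernowne :: "nat \<Rightarrow> nat" where
  "champernowne i = flat (smap decimal_digits (fromN 1)) !! i"

end

theory Submission
  imports Defs "HOL-Library.FuncSet" "HOL-Real_Asymp.Real_Asymp"
begin

text \<open>
  Condition \<open>(*)\<close> with \<open>\<rho> > 1\<close> and \<open>\<epsilon> = 1/2\<close> yields, by the pigeonhole principle, exactly equal
  factors at positions \<open>x < y\<close>, with \<open>y\<close> arbitrarily large, whose length is at least \<open>\<eta> y\<close> for a fixed
  \<open>\<eta> > 0\<close>. Around these positions the numbers being concatenated have \<open>N\<close> and \<open>N + g\<close> digits, where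
  \<open>g\<close> is small compared with \<open>N\<close>. The units digits of the \<open>N\<close>-digit numbers change at every step, while
  in the other reading the units positions move up by \<open>g\<close> places from one number to the next.
  Near a multiple of a high power of 10 two consecutive units positions then fall on
  zeros, which is impossible unless \<open>g = 0\<close> and the two readings are aligned. But aligned readings would
  place the same integer at two different positions.
\<close>

section \<open>Decimal digits and digit counts\<close>

definition digit_count :: "nat \<Rightarrow> nat" where
  "digit_count n = length (decimal_digits n)"

lemma digit_count_pos: "0 < digit_count n"
  unfolding digit_count_def by (subst decimal_digits.simps) auto

lemma less_power_digit_count: "n < 10 ^ digit_count n"
proof (induction n rule: decimal_digits.induct)
  case (1 n)
  show ?case
  proof (cases "n < 10")
    case True
    then show ?thesis by (simp add: digit_count_def decimal_digits.simps)
  next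
    case False
    then have "digit_count n = Suc (digit_count (n div 10))"
      by (simp add: digit_count_def decimal_digits.simps [of n])
    moreover have "n div 10 < 10 ^ digit_count (n div 10)" using 1 False by simp
    ultimately show ?thesis by simp
  qed
qed

lemma power_digit_count_le: "1 \<le> n \<Longrightarrow> 10 ^ (digit_count n - 1) \<le> n"
proof (induction n rule: decimal_digits.induct)
  case (1 n)
  show ?case
  proof (cases "n < 10")
    case True
    then show ?thesis using 1 by (simp add: digit_count_def decimal_digits.simps)
  next
    case False
    then have e: "digit_count n = Suc (digit_count (n div 10))"
      by (simp add: digit_count_def decimal_digits.simps [of n])
    have "10 ^ (digit_count (n div 10) - 1) \<le> n div 10" using 1 False by simp
    then have "10 * 10 ^ (digit_count (n div 10) - 1) \<le> n" by linarith
    then show ?thesis using e digit_count_pos [of "n div 10"]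
      by (metis One_nat_def Suc_pred diff_Suc_1 power_Suc)
  qed
qed

lemma less_digit_count: "10 ^ k \<le> n \<Longrightarrow> k < digit_count n"
  using less_power_digit_count [of n] power_less_imp_less_exp [of "10::nat" k]
  by (meson le_less_trans one_less_numeral_iff semiring_norm(76))

lemma digit_count_mono:
  assumes "m \<le> n" shows "digit_count m \<le> digit_count n"
proof (cases "m = 0")
  case True
  then have "digit_count m = 1" by (simp add: digit_count_def decimal_digits.simps)
  then show ?thesis using digit_count_pos [of n] by simp
next
  case False
  then have "10 ^ (digit_count m - 1) \<le> n" using power_digit_count_le [of m] assms by linarith
  then show ?thesis using less_digit_count by fastforce
qed

lemma decimal_digits_nth:
  "i < digit_count n \<Longrightarrow> decimal_digits n ! i = n div 10 ^ (digit_count n - 1 - i) mod 10"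
proof (induction n arbitrary: i rule: decimal_digits.induct)
  case (1 n)
  show ?case
  proof (cases "n < 10")
    case True
    then show ?thesis using 1 by (simp add: digit_count_def decimal_digits.simps)
  next
    case False
    then have d: "decimal_digits n = decimal_digits (n div 10) @ [n mod 10]"
      by (simp add: decimal_digits.simps [of n])
    then have e: "digit_count n = Suc (digit_count (n div 10))"
      by (simp add: digit_count_def)
    show ?thesis
    proof (cases "i < digit_count (n div 10)")
      case True
      then have "digit_count n - 1 - i = Suc (digit_count (n div 10) - 1 - i)" using e by simp
      moreover have "decimal_digits n ! i = decimal_digits (n div 10) ! i"
        using True by (simp add: d nth_append digit_count_def)
      ultimately show ?thesis using 1(1) [OF False True] by (simp add: div_mult2_eq)
    next
      case False
      then have "i = digit_count (n div 10)" using 1(2) e by simp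
      then show ?thesis using e by (simp add: d nth_append digit_count_def)
    qed
  qed
qed

lemma inj_decimal_digits: "inj decimal_digits"
proof -
  \<comment> \<open>Horner evaluation is a left inverse of \<open>decimal_digits\<close>.\<close>
  have "foldl (\<lambda>a d. 10 * a + d) 0 (decimal_digits n) = n" for n
  proof (induction n rule: decimal_digits.induct)
    case (1 n)
    then show ?case
      by (cases "n < 10") (simp_all add: decimal_digits.simps [of n])
  qed
  then show ?thesis by (metis injI)
qed

section \<open>Positions of the integers in the Champernowne word\<close>

definition start :: "nat \<Rightarrow> nat" where
  "start n = (\<Sum>k = 1..<n. digit_count k)"

lemma start_1 [simp]: "start (Suc 0) = 0"
  by (simp add: start_def)

lemma start_Suc: "1 \<le> n \<Longrightarrow> start (Suc n) = start n + digit_count n"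
  by (simp add: start_def)

text \<open>Induction strips one digit list at a time; \<open>flat\<close> unfolds because no digit
  list is empty. This ties the stream to the arithmetic of \<open>start\<close>.\<close>

lemma sdrop_start:
  "sdrop (start (Suc n)) (flat (smap decimal_digits (fromN 1))) = flat (smap decimal_digits (fromN (Suc n)))"
proof (induction n)
  case 0
  then show ?case by simp
next
  case (Suc n)
  have ne: "decimal_digits k \<noteq> []" for k using digit_count_pos [of k] by (auto simp: digit_count_def)
  have "smap decimal_digits (fromN (Suc n)) = decimal_digits (Suc n) ## smap decimal_digits (fromN (Suc (Suc n)))"
    by (subst siterate.code) simp
  then have "flat (smap decimal_digits (fromN (Suc n)))
      = decimal_digits (Suc n) @- flat (smap decimal_digits (fromN (Suc (Suc n))))"
    using ne by (metis flat_unfold stream.sel)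
  moreover have "sdrop (length u) (u @- v) = v" for u :: "nat list" and v
    by (simp add: sdrop_shift)
  ultimately have "sdrop (digit_count (Suc n)) (flat (smap decimal_digits (fromN (Suc n))))
      = flat (smap decimal_digits (fromN (Suc (Suc n))))"
    by (simp add: digit_count_def)
  then show ?case using Suc by (metis start_Suc sdrop_add le_add1 plus_1_eq_Suc)
qed

lemma champernowne_start:
  assumes "1 \<le> n" "i < digit_count n"
  shows "champernowne (start n + i) = decimal_digits n ! i"
proof -
  obtain k where k: "n = Suc k" using assms by (cases n) auto
  have ne: "decimal_digits k \<noteq> []" for k using digit_count_pos [of k] by (auto simp: digit_count_def)
  have "smap decimal_digits (fromN n) = decimal_digits n ## smap decimal_digits (fromN (Suc n))"
    by (subst siterate.code) simp
  then have "flat (smap decimal_digits (fromN n)) = decimal_digits n @- flat (smap decimal_digits (fromN (Suc n)))"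
    using ne by (metis flat_unfold stream.sel)
  moreover have "champernowne (start n + i) = flat (smap decimal_digits (fromN n)) !! i"
    using sdrop_start [of k] sdrop_snth [of "start n" "flat (smap decimal_digits (fromN 1))" i]
    by (simp add: champernowne_def k)
  ultimately show ?thesis using assms by (simp add: digit_count_def)
qed

lemma start_add_le: "1 \<le> n \<Longrightarrow> start n + k \<le> start (n + k)"
proof (induction k)
  case (Suc k)
  then show ?case using start_Suc [of "n + k"] digit_count_pos [of "n + k"] by simp
qed simp

lemma start_mono: "1 \<le> m \<Longrightarrow> m \<le> n \<Longrightarrow> start m \<le> start n"
  using start_add_le [of m "n - m"] by simp

text \<open>Read backwards, this bounds the number found at a far position from below.\<close>

lemma start_Suc_le: "start (Suc n) \<le> n * digit_count n"
proof -
  have "start (Suc n) \<le> (\<Sum>k = 1..<Suc n. digit_count n)"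
    unfolding start_def by (intro sum_mono digit_count_mono) auto
  then show ?thesis by simp
qed

text \<open>The number whose digits cover position \<open>p\<close>. Taking the least number that
  ends after \<open>p\<close> makes \<open>num_at\<close> and \<open>start\<close> adjoint, as
  \<open>num_at_le_iff\<close> and \<open>le_num_at_iff\<close> record.\<close>

definition num_at :: "nat \<Rightarrow> nat" where
  "num_at p = (LEAST n. p < start (Suc n))"

lemma less_start_Suc_num_at: "p < start (Suc (num_at p))"
proof -
  have "p < start (Suc (Suc p))" using start_add_le [of 1 "Suc p"] by simp
  then show ?thesis unfolding num_at_def by (rule LeastI)
qed

lemma num_at_pos: "1 \<le> num_at p"
  using less_start_Suc_num_at [of p] by (cases "num_at p") auto

lemma start_num_at_le: "start (num_at p) \<le> p"
proof -
  have "\<not> p < start (Suc (num_at p - 1))"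
    using not_less_Least [of "num_at p - 1" "\<lambda>n. p < start (Suc n)"] num_at_pos [of p]
    by (simp add: num_at_def)
  then show ?thesis using num_at_pos [of p] by simp
qed

lemma num_at_le_iff: "num_at p \<le> n \<longleftrightarrow> p < start (Suc n)"
proof
  assume "num_at p \<le> n"
  then show "p < start (Suc n)"
    using less_start_Suc_num_at [of p] start_mono [of "Suc (num_at p)" "Suc n"] by simp
next
  assume "p < start (Suc n)"
  then show "num_at p \<le> n" unfolding num_at_def by (rule Least_le)
qed

lemma le_num_at_iff: "1 \<le> n \<Longrightarrow> n \<le> num_at p \<longleftrightarrow> start n \<le> p"
  using num_at_le_iff [of p "n - 1"] by auto

lemma num_at_mono: "p \<le> p' \<Longrightarrow> num_at p \<le> num_at p'"
  using num_at_le_iff less_start_Suc_num_at le_less_trans by blast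

text \<open>Each number occupies at least one position, so \<open>k\<close> positions pass at most
  \<open>k\<close> numbers.\<close>

lemma num_at_add_le: "num_at (p + k) \<le> num_at p + k"
  unfolding num_at_le_iff
  using less_start_Suc_num_at [of p] start_add_le [of "Suc (num_at p)" k] by simp

lemma num_at_le: "num_at p \<le> p + 1"
  using num_at_add_le [of 0 p] num_at_le_iff [of 0 1] digit_count_pos [of 1] start_Suc [of 1] by simp

lemma start_add_constant_length:
  assumes "1 \<le> n" "digit_count n = N" "digit_count (n + j) = N" 
  shows "start (n + j) = start n + j * N"
  using assms(3)
proof (induction j)
  case (Suc j)
  then have "digit_count (n + j) = N"
    using digit_count_mono [of n "n + j"] digit_count_mono [of "n + j" "n + Suc j"] assms(2) by simp
  then show ?case using Suc start_Suc [of "n + j"] assms(1) by simp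
qed simp

lemma champernowne_read:
  assumes "1 \<le> n" "digit_count n = N" "digit_count (n + j) = N" "i < N"
  shows "champernowne (start n + j * N + i) = (n + j) div 10 ^ (N - 1 - i) mod 10"
  using assms champernowne_start [of "n + j" i] start_add_constant_length [OF assms(1-3)]
    decimal_digits_nth [of i "n + j"] by simp

section \<open>One word read with two block lengths\<close>

text \<open>
  The word \<open>w\<close> is read both as consecutive \<open>N\<close>-digit numbers, \<open>l\<close> being the position of the units
  digit of \<open>n\<close>, and as consecutive \<open>(N + g)\<close>-digit numbers, \<open>m\<close> starting at position \<open>z\<close>. For
  \<open>k < 10 ^ b\<close> the digits of \<open>m + k\<close> at the places \<open>b, \<dots>, h - 1\<close> vanish.
\<close>

lemma read_aligned:
  fixes w :: "nat \<Rightarrow> nat"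
  assumes low: "\<And>j. j \<le> J \<Longrightarrow> w (l + j * N) = (n + j) mod 10"
    and num: "\<And>k i. k \<le> J \<Longrightarrow> i < N + g \<Longrightarrow> w (z + k * (N + g) + i) = (m + k) div 10 ^ (N + g - 1 - i) mod 10"
    and l: "z \<le> l" "l < z + (N + g)"
    and m: "10 ^ h dvd m" and h: "b + 2 * g \<le> h" "h \<le> N + g" "0 < b"
    and J: "N + g + b + 1 \<le> J" "J < 10 ^ b"
  shows "g = 0 \<and> l = z + N - 1"
proof -
  define N' where "N' = N + g"
  have zero: "(m + k) div 10 ^ v mod 10 = 0" if "k < 10 ^ b" "b \<le> v" "v < h" for k v
  proof -
    obtain c where c: "m = 10 ^ h * c" using m by blast
    have "(10::nat) ^ h = 10 ^ v * (10 * 10 ^ (h - v - 1))"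
      using that by (metis power_add power_Suc Suc_diff_1 le_add_diff_inverse less_imp_le zero_less_diff diff_diff_left)
    then have "m = (10 * 10 ^ (h - v - 1) * c) * 10 ^ v" using c by (simp add: algebra_simps)
    moreover have "k < 10 ^ v" using that power_increasing [of b v "10::nat"] by linarith
    ultimately have "(m + k) div 10 ^ v = 10 * 10 ^ (h - v - 1) * c" by simp
    then show ?thesis by simp
  qed
  have step: "(a + 1) mod 10 \<noteq> a mod (10::nat)" for a by (simp add: mod_Suc)
  \<comment> \<open>\<open>v0\<close> is the decimal place of \<open>m\<close> on which position
    \<open>l\<close> falls; \<open>v0 = 0\<close> means that \<open>l\<close> is also the units
    position of \<open>m\<close>.\<close>
  define v0 where "v0 = z + N' - 1 - l"
  have v0: "v0 < N'" "l = z + (N' - 1 - v0)" using l unfolding v0_def N'_def by auto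
  show ?thesis
  proof (cases "g = 0")
    case True
    have "v0 = 0"
    proof (rule ccontr)
      assume "v0 \<noteq> 0"
      \<comment> \<open>As 10 divides \<open>m\<close>, only the units digit changes from
        \<open>m\<close> to \<open>m + 1\<close>. At a place \<open>v0 > 0\<close> the letters at
        \<open>l\<close> and \<open>l + N'\<close> would agree, but they are the units digits of
        \<open>n\<close> and \<open>n + 1\<close>.\<close>
      have "10 ^ 1 dvd (10::nat) ^ h" using h by (intro le_imp_power_dvd) auto
      then have "10 dvd m" using m by (metis dvd_trans power_one_right)
      then have "(m + 1) div 10 = m div 10" by (auto elim!: dvdE)
      then have "(m + 1) div 10 ^ v0 = m div 10 ^ v0"
        using \<open>v0 \<noteq> 0\<close> by (cases v0) (auto simp: div_mult2_eq)
      moreover have "w l = m div 10 ^ v0 mod 10" "w (l + N') = (m + 1) div 10 ^ v0 mod 10"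
        using num [of 0 "N' - 1 - v0"] num [of 1 "N' - 1 - v0"] v0 J True
        by (auto simp: N'_def algebra_simps)
      ultimately show False using low [of 0] low [of 1] J True step [of n] by (simp add: N'_def)
    qed
    then show ?thesis using True v0 unfolding N'_def by simp
  next
    case False
    \<comment> \<open>Relative to \<open>m + j\<close>, position \<open>l + j * N\<close> has place
      \<open>v0 + j * g\<close>. The rounded-up quotient is the least \<open>j\<close> with
      \<open>v0 + j * g \<ge> N' + b\<close>: there the place has wrapped past \<open>N'\<close>
      into the preceding number \<open>m + (j - 1)\<close>, at a place \<open>v\<close> in the range
      from \<open>b\<close> to \<open>b + g - 1\<close>.\<close>
    define j where "j = (N' + b - v0 + (g - 1)) div g"
    have "N' + b - v0 + (g - 1) = j * g + (N' + b - v0 + (g - 1)) mod g"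
      unfolding j_def by simp
    moreover have "(N' + b - v0 + (g - 1)) mod g < g" using False by simp
    ultimately have jg: "N' + b \<le> v0 + j * g" "v0 + j * g < N' + b + g" using v0 False by linarith+
    define v where "v = v0 + j * g - N'"
    have v: "b \<le> v" "v < b + g" using jg unfolding v_def by linarith+
    have "j \<noteq> 0" using jg v0 by (cases j) auto
    then obtain k where k: "j = Suc k" by (cases j) auto
    \<comment> \<open>This keeps the indices \<open>j\<close> and \<open>j + 1\<close> within
      \<open>J\<close>, hence below \<open>10 ^ b\<close>.\<close>
    have "k < N' + b"
    proof (rule ccontr)
      assume "\<not> k < N' + b"
      then have "(N' + b) * 1 + g \<le> k * g + g" using False by (intro add_mono mult_mono) auto
      then show False using jg k by simp
    qed
    have vN: "v + g < h" "v + g < N'" using v h unfolding N'_def by auto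
    have gN: "N' = N + g" by (simp add: N'_def)
    have "int (l + j * N) = int (z + k * N' + (N' - 1 - v))"
    proof -
      have "int l = int z + int N + int g - 1 - int v0" using v0 gN by simp
      moreover have "int v = int v0 + int j * int g - int N - int g" using jg gN unfolding v_def
        by (simp add: of_nat_diff)
      moreover have "int (N' - 1 - v) = int N + int g - 1 - int v" using vN gN by simp
      moreover have "int (k * N') = int k * (int N + int g)" using gN by simp
      ultimately show ?thesis by (simp add: k algebra_simps)
    qed
    then have p1: "l + j * N = z + k * N' + (N' - 1 - v)" by linarith
    then have p2: "l + Suc j * N = z + Suc k * N' + (N' - 1 - (v + g))"
      using vN gN by simp
    \<comment> \<open>Both \<open>v\<close> and \<open>v + g\<close> lie between \<open>b\<close>
      and \<open>h - 1\<close>, so two consecutive units digits vanish, against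
      \<open>step\<close>.\<close>
    have "w (l + j * N) = 0"
      unfolding p1 using num [of k "N' - 1 - v"] zero [of k v] vN v \<open>k < N' + b\<close> J gN by simp
    moreover have "w (l + Suc j * N) = 0"
      unfolding p2 using num [of "Suc k" "N' - 1 - (v + g)"] zero [of "Suc k" "v + g"] vN v \<open>k < N' + b\<close> J gN
      by (simp add: add.commute [of v g])
    ultimately show ?thesis
      using low [of j] low [of "Suc j"] step [of "n + j"] \<open>k < N' + b\<close> J gN k by simp
  qed
qed

section \<open>An exact common run inside close words\<close>

text \<open>Removing \<delta> intervals leaves at most \<delta> + 1 gaps, and by pigeonhole one gap
  holds its share of the uncovered positions. The words agree throughout a gap.\<close>

lemma close_words_common_run:
  assumes "close_words \<epsilon> \<delta> U V"
  shows "\<exists>u M. u + M \<le> length U \<and> (1 - \<epsilon>) * real (length U) \<le> real (\<delta> + 1) * real M \<and>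
           (\<forall>i<M. U ! (u + i) = V ! (u + i))"
proof -
  obtain I :: "nat \<Rightarrow> nat set" where
    I: "\<And>j. j \<in> {1..\<delta>} \<Longrightarrow> (\<exists>p q. I j = {p..q}) \<and> I j \<subseteq> {1..length U}"
    and diff: "{i \<in> {1..length U}. U ! (i - 1) \<noteq> V ! (i - 1)} \<subseteq> (\<Union>j\<in>{1..\<delta>}. I j)"
    and card: "real (card (\<Union>j\<in>{1..\<delta>}. I j)) \<le> \<epsilon> * real (length U)"
    using assms unfolding close_words_def by blast
  obtain p q where pq: "\<And>j. j \<in> {1..\<delta>} \<Longrightarrow> I j = {p j..q j}" using I by metis
  define C where "C = (\<Union>j\<in>{1..\<delta>}. I j)"
  define A where "A = {1..length U} - C"
  \<comment> \<open>Between two uncovered points with the same number of interval starts to their left,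
    every point is uncovered.\<close>
  define S where "S a = {j \<in> {1..\<delta>}. p j \<le> a}" for a
  have "C \<subseteq> {1..length U}" unfolding C_def using I by blast
  then have cardA: "card A = length U - card C" "card C \<le> length U"
    unfolding A_def using card_Diff_subset [of C "{1..length U}"] card_mono [of "{1..length U}" C]
    by (auto intro: finite_subset)
  have "card (S a) \<le> card {1..\<delta>}" for a
    unfolding S_def by (intro card_mono) auto
  then have "(\<lambda>a. card (S a)) \<in> A \<rightarrow> {0..\<delta>}" by auto
  then obtain y where y: "card ((\<lambda>a. card (S a)) -` {y} \<inter> A) * card {0..\<delta>} \<ge> card A"
    using pigeonhole_card [of "\<lambda>a. card (S a)" A "{0..\<delta>}"] unfolding A_def by auto
  define F where "F = (\<lambda>a. card (S a)) -` {y} \<inter> A"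
  have large: "(1 - \<epsilon>) * real (length U) \<le> real (\<delta> + 1) * real (card F)"
  proof -
    have "real (card A) \<le> real (\<delta> + 1) * real (card F)"
      using y unfolding F_def [symmetric] of_nat_mult [symmetric] of_nat_le_iff
      by (simp add: mult.commute)
    then show ?thesis using cardA card unfolding C_def by (simp add: algebra_simps)
  qed
  have finF: "finite F" unfolding F_def A_def by auto
  show ?thesis
  proof (cases "F = {}")
    \<comment> \<open>Here \<open>large\<close> makes the left-hand side at most 0, and the empty
      run suffices.\<close>
    case True
    then show ?thesis using large by (intro exI [of _ 0]) auto
  next
    case False
    define u v where "u = Min F" and "v = Max F"
    have uv: "u \<in> F" "v \<in> F" "u \<le> v"
      using finF False unfolding u_def v_def by auto
    have "F \<subseteq> {u..v}" using finF unfolding u_def v_def by auto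
    then have "card F \<le> Suc v - u" using card_mono [of "{u..v}" F] by simp
    then have "real (\<delta> + 1) * real (card F) \<le> real (\<delta> + 1) * real (Suc v - u)"
      by (intro mult_left_mono) auto
    \<comment> \<open>The intervals count positions from 1 and lists from 0, hence
      \<open>u - 1\<close>.\<close>
    moreover have "U ! (u - 1 + i) = V ! (u - 1 + i)" if "i < Suc v - u" for i
    proof -
      have uA: "1 \<le> u" "v \<le> length U" "u \<notin> C" using uv unfolding F_def A_def by auto
      have Suv: "S u = S v"
      proof (rule card_subset_eq)
        show "card (S u) = card (S v)" using uv unfolding F_def by simp
      qed (use uv in \<open>auto simp: S_def\<close>)
      have "u + i \<notin> C"
      proof
        assume "u + i \<in> C"
        then obtain j where j: "j \<in> {1..\<delta>}" "p j \<le> u + i" "u + i \<le> q j"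
          unfolding C_def using pq by auto
        then have "j \<in> S v" using that by (auto simp: S_def)
        then have "p j \<le> u" using Suv by (auto simp: S_def)
        then have "u \<in> I j" using j pq [of j] by auto
        then have "u \<in> C" using j unfolding C_def by blast
        then show False using uA by simp
      qed
      moreover have "u + i \<in> {1..length U}" using uA that by auto
      ultimately have "U ! (u + i - 1) = V ! (u + i - 1)" using diff unfolding C_def by blast
      then show ?thesis using uA by simp
    qed
    moreover have "u - 1 + (Suc v - u) \<le> length U"
      using uv unfolding F_def A_def by auto
    ultimately show ?thesis using large by (meson order_trans)
  qed
qed

section \<open>Repetitions inside windows of constant digit count\<close>

text \<open>As long as the numbers have \<open>N\<close> digits, each step moves the start by
  \<open>N\<close>, so \<open>num_at p + j\<close> starts no later than \<open>p + W\<close> and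
  lies between two numbers with \<open>N\<close> digits.\<close>

lemma digit_count_num_at_add:
  assumes "digit_count (num_at p) = N" "digit_count (num_at (p + W)) = N" "j * N \<le> W"
  shows "digit_count (num_at p + j) = N"
  using assms(3)
proof (induction j)
  case (Suc j)
  then have "digit_count (num_at p + j) = N" by simp
  then have "start (num_at p + Suc j) = start (num_at p) + Suc j * N"
    using start_add_constant_length [OF num_at_pos assms(1), of j] start_Suc [of "num_at p + j"]
      num_at_pos [of p] by simp
  then have "start (num_at p + Suc j) \<le> p + W" using start_num_at_le [of p] Suc.prems by linarith
  then have "num_at p + Suc j \<le> num_at (p + W)" by (simp add: le_num_at_iff)
  then show ?case
    using digit_count_mono [of "num_at p + Suc j" "num_at (p + W)"]
      digit_count_mono [of "num_at p" "num_at p + Suc j"] assms by simp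
qed (use assms in simp)

text \<open>The occurrence at \<open>Y\<close> soon reaches a multiple \<open>m\<close> of a high
  power of 10. Around the copy of \<open>m\<close> in the occurrence at \<open>X\<close>,
  \<open>read_aligned\<close> forces equal block lengths and a common start, so the same integer
  would start at two positions.\<close>

lemma no_repetition_constant_length:
  assumes "X < Y" and rep: "\<And>i. i < W \<Longrightarrow> champernowne (X + i) = champernowne (Y + i)"
    and N: "digit_count (num_at X) = N" "digit_count (num_at (X + W)) = N"
    and N': "digit_count (num_at Y) = N'" "digit_count (num_at (Y + W)) = N'"
    and q: "N' \<le> N + q" "0 < q" "3 * q \<le> N'" "N' + q + 2 \<le> 10 ^ q"
    and W: "(10 ^ (3 * q) + 10 ^ q + 5) * N' \<le> W"
  shows False
proof -
  \<comment> \<open>\<open>read_aligned\<close> will be used with \<open>b = q\<close> and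
    \<open>h = 3 * q\<close>, where \<open>b + 2 * g \<le> h\<close> follows from
    \<open>g \<le> q\<close>. \<open>J\<close> is the least value it permits, and \<open>m\<close>
    is the first multiple of \<open>D\<close> above \<open>num_at Y\<close>.\<close>
  define D where "D = (10::nat) ^ (3 * q)"
  define J where "J = N' + q + 1"
  define m where "m = D * (num_at Y div D + 1)"
  define a where "a = m - num_at Y"
  have "0 < D" by (simp add: D_def)
  then have a: "m = num_at Y + a" "0 < a" "a \<le> D"
  proof -
    have "num_at Y = D * (num_at Y div D) + num_at Y mod D" by simp
    moreover have "num_at Y mod D < D" using \<open>0 < D\<close> by simp
    moreover have "m = D * (num_at Y div D) + D" by (simp add: m_def)
    ultimately have "num_at Y < m \<and> m \<le> num_at Y + D" by linarith
    then show "m = num_at Y + a" "0 < a" "a \<le> D" unfolding a_def by auto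
  qed
  \<comment> \<open>The three terms pay for reaching \<open>m\<close>, for reading \<open>J\<close>
    blocks, and for a margin at the ends.\<close>
  have W': "D * N' + J * N' + 5 * N' \<le> W"
  proof -
    have "J * N' \<le> 10 ^ q * N'" using q by (intro mult_right_mono) (auto simp: J_def)
    moreover have "(D + 10 ^ q + 5) * N' = D * N' + 10 ^ q * N' + 5 * N'"
      by (simp only: add_mult_distrib)
    ultimately show ?thesis using W unfolding D_def by linarith
  qed
  have NN': "N \<le> N'" using digit_count_mono [OF num_at_mono [of X Y]] \<open>X < Y\<close> N N' by simp
  define g where "g = N' - N"
  have gN: "N' = N + g" "g \<le> q" using NN' q by (auto simp: g_def)
  have m1: "1 \<le> m" using a num_at_pos [of Y] by simp
  have dm: "digit_count (m + k) = N'" if "k \<le> J" for k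
  proof -
    have "(a + k) * N' \<le> D * N' + J * N'" using a that by (simp add: add_mult_distrib add_mono)
    then show ?thesis
      using digit_count_num_at_add [OF N', of "a + k"] W' a by (simp add: add.assoc)
  qed
  have startm: "start m = start (num_at Y) + a * N'"
    using start_add_constant_length [OF num_at_pos N'(1), of a] dm [of 0] a by simp
  have zY: "Y < start m" using num_at_le_iff [of Y "m - 1"] a m1 by auto
  have zY': "start m \<le> Y + D * N'"
    using startm start_num_at_le [of Y] mult_le_mono1 [OF a(3), of N'] by linarith
  \<comment> \<open>The position in the occurrence at \<open>X\<close> that matches
    \<open>start m\<close> in the occurrence at \<open>Y\<close>.\<close>
  define z where "z = X + (start m - Y)"
  have zX: "X < z" "z < start m" "z \<le> X + D * N'" using zY zY' \<open>X < Y\<close> by (auto simp: z_def)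
  have transfer: "champernowne (z + i) = champernowne (start m + i)" if "i < W - D * N'" for i
  proof -
    have "(start m - Y) + i < W" using that zY' by linarith
    then show ?thesis using rep [of "start m - Y + i"] zY by (simp add: z_def add.assoc)
  qed
  define n where "n = num_at z"
  have XW: "z + (X + W - z) = X + W" using zX W' by simp
  have dz: "digit_count (num_at z) = N"
    using digit_count_mono [OF num_at_mono [of X z]] digit_count_mono [OF num_at_mono [of z "X + W"]]
      N zX XW by simp
  have dn: "digit_count (n + j) = N" if "j \<le> J" for j
  proof -
    have "j * N \<le> J * N'" using that NN' by (intro mult_mono) auto
    then have "j * N \<le> X + W - z" using zX W' by linarith
    then show ?thesis
      using digit_count_num_at_add [OF dz, of "X + W - z" j] N XW by (simp add: n_def)
  qed
  have n1: "1 \<le> n" unfolding n_def by (rule num_at_pos)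
  have sn: "start n \<le> z" "z < start n + N"
    using start_num_at_le [of z] less_start_Suc_num_at [of z] start_Suc [OF n1] dz by (auto simp: n_def)
  have N0: "0 < N" using dz digit_count_pos by metis
  define l where "l = start n + (N - 1)"
  have "g = 0 \<and> l = z + N - 1"
  proof (rule read_aligned [where w = champernowne and J = J and n = n and m = m and h = "3 * q" and b = q])
    show "champernowne (l + j * N) = (n + j) mod 10" if "j \<le> J" for j
      using champernowne_read [OF n1, of N j "N - 1"] dn [of 0] dn [OF that] N0
      by (simp add: l_def algebra_simps)
    show "champernowne (z + k * (N + g) + i) = (m + k) div 10 ^ (N + g - 1 - i) mod 10"
      if "k \<le> J" "i < N + g" for k i
    proof -
      have "k * N' \<le> J * N'" using that by simp
      then have "k * N' + i < W - D * N'" using W' that gN by linarith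
      then show ?thesis
        using transfer [of "k * N' + i"] champernowne_read [OF m1, of N' k i] dm [of 0] dm [of k] that gN
        by (simp add: add.assoc)
    qed
    show "z \<le> l" "l < z + (N + g)" using sn N0 by (auto simp: l_def)
    show "10 ^ (3 * q) dvd m" by (simp add: m_def D_def)
  qed (use q gN in \<open>auto simp: J_def\<close>)
  then have *: "N' = N" "z = start n" using gN N0 by (auto simp: l_def)
  have "decimal_digits n = decimal_digits m"
  proof (rule nth_equalityI)
    show "length (decimal_digits n) = length (decimal_digits m)"
      using dn [of 0] dm [of 0] * by (simp add: digit_count_def)
    show "decimal_digits n ! i = decimal_digits m ! i" if "i < length (decimal_digits n)" for i
    proof -
      have i: "i < N" using that dn [of 0] by (simp add: digit_count_def)
      then have "i < W - D * N'" using W' * by linarith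
      then show ?thesis
        using transfer [of i] champernowne_start [OF n1, of i] champernowne_start [OF m1, of i]
          dn [of 0] dm [of 0] * i by simp
    qed
  qed
  then have "n = m" using inj_decimal_digits by (simp add: inj_eq)
  \<comment> \<open>\<open>z = start n = start m\<close> contradicts
    \<open>z < start m\<close>.\<close>
  then show False using * zX by simp
qed

text \<open>Over \<open>3 * W\<close> positions the number at most doubles, too little to gain two
  digits.\<close>

lemma digit_count_three_windows:
  assumes "3 * W \<le> num_at p"
  shows "digit_count (num_at (p + 3 * W)) \<le> digit_count (num_at p) + 1"
proof (rule ccontr)
  assume "\<not> ?thesis"
  then have "10 ^ (digit_count (num_at p) + 1) \<le> (10::nat) ^ (digit_count (num_at (p + 3 * W)) - 1)"
    by (intro power_increasing) auto
  also have "\<dots> \<le> num_at (p + 3 * W)" by (rule power_digit_count_le [OF num_at_pos])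
  also have "\<dots> \<le> 2 * num_at p" using num_at_add_le [of p "3 * W"] assms by simp
  also have "\<dots> < 2 * 10 ^ digit_count (num_at p)" using less_power_digit_count by simp
  finally show False by simp
qed

section \<open>No repetition of length proportional to its position\<close>

text \<open>The scales are: \<open>10 ^ d\<close> comparable to \<open>y\<close>,
  \<open>T = 10 ^ q\<close> roughly its eighth root, windows of length \<open>3 * T ^ 3 * d\<close>,
  and a repetition of length at least \<eta> \<open>y\<close>. Since \<open>d\<close> is tiny
  against \<eta> \<open>T\<close>, three windows fit easily and the digit counts on the two sides
  differ by less than \<open>q\<close>.\<close>

lemma no_long_repetition:
  fixes \<eta> :: real
  assumes \<eta>: "0 < \<eta>" "\<eta> \<le> 1"
  obtains y\<^sub>0 where "\<And>x y M. x < y \<Longrightarrow> y\<^sub>0 \<le> y \<Longrightarrow> \<eta> * real y \<le> real M \<Longrightarrow>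
    \<exists>i<M. champernowne (x + i) \<noteq> champernowne (y + i)"
proof -
  \<comment> \<open>With \<open>d \<le> 8 * q + 7\<close>, the constant 1000 = 8 * 125 gives the
    bound \<open>dT\<close>.\<close>
  have "\<forall>\<^sub>F q in sequentially. 1000 * (real q + 1) / \<eta> \<le> 10 ^ q"
    using \<eta>(1) by real_asymp
  then obtain q\<^sub>0 where q\<^sub>0: "\<And>q. q\<^sub>0 \<le> q \<Longrightarrow> 1000 * (real q + 1) / \<eta> \<le> 10 ^ q"
    unfolding eventually_sequentially by blast
  have "False" if xy: "x < y" and y: "10 ^ (8 * (q\<^sub>0 + 1)) \<le> y" and M: "\<eta> * real y \<le> real M"
    and rep: "\<And>i. i < M \<Longrightarrow> champernowne (x + i) = champernowne (y + i)" for x y M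
  proof -
    \<comment> \<open>All positions inspected are at most \<open>y + 2 * H \<le> 2 * y\<close>, and
      \<open>num_at p \<le> p + 1\<close>, so \<open>d\<close> bounds every digit count on either
      side.\<close>
    define d where "d = digit_count (2 * y + 1)"
    define q where "q = d div 8"
    have "8 * (q\<^sub>0 + 1) < d" unfolding d_def using y by (intro less_digit_count) simp
    then have q: "q\<^sub>0 \<le> q" "0 < q" by (auto simp: q_def)
    have d8: "8 * q \<le> d" "d \<le> 8 * q + 7" by (auto simp: q_def)
    define T where "T = (10::real) ^ q"
    have T1000: "1000 * (real q + 1) \<le> \<eta> * T"
      using q\<^sub>0 [OF q(1)] \<eta> by (simp add: T_def field_simps)
    have "\<eta> * T \<le> T" using \<eta> by (simp add: T_def)
    then have T: "1000 * (real q + 1) \<le> T" "1000 \<le> \<eta> * T" "1000 \<le> T"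
      using T1000 by (smt (verit) of_nat_0_le_iff)+
    have dT: "real d \<le> \<eta> * T / 125"
    proof -
      have "real d \<le> 8 * real q + 7" using d8 by linarith
      then have "125 * real d \<le> 1000 * (real q + 1)" by (simp add: algebra_simps)
      then show ?thesis using T1000 by simp
    qed
    have y_lower: "10 ^ d \<le> 30 * real y"
    proof -
      have "10 ^ (d - 1) \<le> 2 * y + 1" unfolding d_def by (rule power_digit_count_le) simp
      also have "\<dots> \<le> 3 * y" using xy by simp
      finally have "10 * 10 ^ (d - 1) \<le> 30 * y" by simp
      moreover have "10 * (10::nat) ^ (d - 1) = 10 ^ d" using d8 q by (cases d) auto
      ultimately have "10 ^ d \<le> 30 * y" by simp
      then have "real (10 ^ d) \<le> real (30 * y)" by (rule of_nat_mono)
      then show ?thesis by simp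
    qed
    have T8: "T ^ 8 \<le> 10 ^ d"
      unfolding T_def power_mult [symmetric] using d8 by (intro power_increasing) auto
    \<comment> \<open>Half of the repetition is skipped: \<open>x\<close> may be small, but the
      number \<open>n\<close> at \<open>x + H\<close> satisfies \<open>H \<le> n * d\<close>, hence
      has nearly \<open>d\<close> digits. The windows lie in the other half.\<close>
    define H where "H = nat \<lfloor>\<eta> * real y / 2\<rfloor>"
    have "0 \<le> \<eta> * real y / 2" using \<eta> by simp
    then have H: "real H \<le> \<eta> * real y / 2" "\<eta> * real y / 2 - 1 < real H" unfolding H_def by linarith+
    have "2 * H \<le> M" using H M by linarith
    have "\<eta> * real y \<le> real y" using \<eta> by (simp add: mult_left_le_one_le)
    then have "2 * H \<le> y" using H by linarith
    have eta_d: "\<eta> * 10 ^ d \<le> 30 * (\<eta> * real y)" using y_lower \<eta> by simp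
    have eta_T8: "\<eta> * T ^ 8 \<le> \<eta> * 10 ^ d" using T8 \<eta> by simp
    \<comment> \<open>Rounding costs \<open>H\<close> less than 1; once \<eta> \<open>y\<close> is
      at least 4, this is absorbed in passing from the factor 60 to 30 in
      \<open>H_lower\<close>.\<close>
    have "1000 * 1 \<le> (\<eta> * T) * T ^ 7" using T by (intro mult_mono) auto
    also have "\<dots> = \<eta> * T ^ 8" by (simp add: power_numeral_reduce)
    finally have "33 \<le> \<eta> * real y" using eta_d eta_T8 by linarith
    then have H_lower: "\<eta> * 10 ^ d \<le> 120 * real H" using H eta_d by linarith
    define W where "W = 3 * 10 ^ (3 * q) * d"
    have W: "real W = 3 * T ^ 3 * real d" by (simp add: W_def T_def power_mult mult.commute)
    define X where "X = x + H"
    define Y where "Y = y + H"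
    define n where "n = num_at X"
    have H3: "3 * W \<le> H"
    proof -
      have "real (3 * W) \<le> 9 * T ^ 3 * (\<eta> * T / 125)"
        using W mult_left_mono [OF dT, of "9 * T ^ 3"] T by simp
      also have "\<dots> = (\<eta> * T ^ 4) * (9 / 125)" by (simp add: power_numeral_reduce)
      also have "\<dots> \<le> (\<eta> * T ^ 4) * (T ^ 4 / 120)"
      proof (rule mult_left_mono)
        have "1000 * 1 \<le> T * T ^ 3" using T by (intro mult_mono) auto
        then show "9 / 125 \<le> T ^ 4 / 120" by (simp add: power_numeral_reduce)
      qed (use \<eta> T in auto)
      also have "\<dots> = \<eta> * T ^ 8 / 120" by (simp add: power_numeral_reduce)
      also have "\<dots> \<le> real H" using eta_T8 H_lower by linarith
      finally show ?thesis by simp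
    qed
    have upper: "digit_count (num_at p) \<le> d" if "p \<le> 2 * y" for p
      unfolding d_def using num_at_le [of p] that by (intro digit_count_mono) simp
    have nd: "real H \<le> real n * real d"
    proof -
      have "H \<le> n * digit_count n"
        using less_start_Suc_num_at [of X] start_Suc_le [of n] unfolding n_def X_def by linarith
      also have "\<dots> \<le> n * d"
        unfolding n_def using xy \<open>2 * H \<le> y\<close> by (intro mult_left_mono upper) (auto simp: X_def)
      finally show ?thesis by (metis of_nat_le_iff of_nat_mult)
    qed
    have dpos: "0 < real d" using d8 q by simp
    have n_W: "3 * W \<le> n"
    proof -
      have "real d * real d \<le> (\<eta> * T / 125) * (T / 125)"
        using dT \<open>\<eta> * T \<le> T\<close> by (intro mult_mono) auto
      then have "real (3 * W) * real d \<le> 9 * T ^ 3 * ((\<eta> * T / 125) * (T / 125))"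
        using W mult_left_mono [of "real d * real d" "(\<eta> * T / 125) * (T / 125)" "9 * T ^ 3"] T
        by (simp add: mult.assoc)
      also have "\<dots> = (\<eta> * T ^ 5) * (9 / 15625)" by (simp add: power_numeral_reduce)
      also have "\<dots> \<le> (\<eta> * T ^ 5) * (T ^ 3 / 120)"
      proof (rule mult_left_mono)
        have "1000 * 1 \<le> T * T ^ 2" using T by (intro mult_mono) auto
        then show "9 / 15625 \<le> T ^ 3 / 120" by (simp add: power_numeral_reduce)
      qed (use \<eta> T in auto)
      also have "\<dots> = \<eta> * T ^ 8 / 120" by (simp add: power_numeral_reduce)
      also have "\<dots> \<le> real n * real d" using eta_T8 H_lower nd by linarith
      finally show ?thesis using dpos by (metis mult_le_cancel_right_pos of_nat_le_iff)
    qed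
    \<comment> \<open>From \<open>H \<le> n * d\<close> and the bound on \<open>d\<close>,
      \<open>10 ^ d\<close> is less than \<open>10 ^ digit_count n * T\<close>; comparing exponents
      gives the claim.\<close>
    have d_lower: "d < digit_count n + q"
    proof -
      have "\<eta> * 10 ^ d \<le> 120 * (real n * (\<eta> * T / 125))"
        using H_lower nd mult_left_mono [OF dT, of "real n"] by linarith
      also have "\<dots> = \<eta> * ((120 / 125) * (real n * T))" by simp
      finally have "10 ^ d \<le> (120 / 125) * (real n * T)" using \<eta> by (metis mult_le_cancel_left_pos)
      also have "\<dots> \<le> real n * T" using T by simp
      also have "\<dots> < 10 ^ digit_count n * T"
      proof (rule mult_strict_right_mono)
        show "real n < 10 ^ digit_count n"
          using less_power_digit_count [of n] by (metis of_nat_less_iff of_nat_numeral of_nat_power)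
      qed (use T in auto)
      also have "\<dots> = 10 ^ (digit_count n + q)" by (simp add: T_def power_add)
      finally show ?thesis by (metis power_less_imp_less_exp one_less_numeral_iff semiring_norm(76))
    qed
    have small: "d + q + 2 \<le> 10 ^ q"
    proof -
      have "d + q + 2 \<le> 9 * q + 9" using d8 by linarith
      then have "real (d + q + 2) \<le> real (9 * q + 9)" by (rule of_nat_mono)
      also have "\<dots> \<le> 1000 * (real q + 1)" by simp
      also have "\<dots> \<le> T" by (rule T(1))
      also have "T = real (10 ^ q)" by (simp add: T_def)
      finally show ?thesis by linarith
    qed
    \<comment> \<open>Either side crosses at most one power of 10 within three windows of length \<open>W\<close>, so
      one of the windows is crossed on neither side.\<close>
    have contra: False
      if i: "i < 3"
        and cX: "digit_count (num_at (X + i * W)) = digit_count (num_at (X + i * W + W))"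
        and cY: "digit_count (num_at (Y + i * W)) = digit_count (num_at (Y + i * W + W))" for i
    proof -
      have "Suc i * W \<le> 3 * W" using i by (intro mult_le_mono1) simp
      then have iW: "i * W + W \<le> H" using H3 mult_Suc [of i W] by linarith
      define N N' where "N = digit_count (num_at (X + i * W))"
        and "N' = digit_count (num_at (Y + i * W))"
      have "digit_count n \<le> N" unfolding N_def n_def by (intro digit_count_mono num_at_mono) simp
      have "N \<le> N'" unfolding N_def N'_def X_def Y_def
        using xy by (intro digit_count_mono num_at_mono) simp
      have "N' \<le> d" unfolding N'_def using iW \<open>2 * H \<le> y\<close> by (intro upper) (auto simp: Y_def)
      have "10 ^ q \<le> (10::nat) ^ (3 * q)" by (intro power_increasing) auto
      then have "10 ^ (3 * q) + 10 ^ q + 5 \<le> 3 * (10::nat) ^ (3 * q)" using small d8 q by linarith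
      then have "(10 ^ (3 * q) + 10 ^ q + 5) * N' \<le> W"
        unfolding W_def using \<open>N' \<le> d\<close> by (intro mult_mono) auto
      show False
      proof (rule no_repetition_constant_length)
        show "X + i * W < Y + i * W" using xy by (simp add: X_def Y_def)
        show "champernowne (X + i * W + k) = champernowne (Y + i * W + k)" if "k < W" for k
          using rep [of "H + i * W + k"] that iW \<open>2 * H \<le> M\<close> by (simp add: X_def Y_def algebra_simps)
        show "(10 ^ (3 * q) + 10 ^ q + 5) * N' \<le> W" by fact
        show "N' \<le> N + q" using \<open>N' \<le> d\<close> d_lower \<open>digit_count n \<le> N\<close> by linarith
        show "3 * q \<le> N'" using \<open>N \<le> N'\<close> d_lower \<open>digit_count n \<le> N\<close> d8 by linarith
        show "N' + q + 2 \<le> 10 ^ q" using \<open>N' \<le> d\<close> small by linarith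
      qed (use cX cY q in \<open>auto simp: N_def N'_def\<close>)
    qed
    have mono: "digit_count (num_at (Z + i * W)) \<le> digit_count (num_at (Z + i * W + W))" for Z i
      by (intro digit_count_mono num_at_mono) simp
    have "3 * W \<le> num_at Y"
      using n_W num_at_mono [of X Y] xy unfolding n_def by (simp add: X_def Y_def)
    then show False
      using contra [of 0] contra [of 1] contra [of 2] mono [of X 0] mono [of X 1] mono [of X 2]
        mono [of Y 0] mono [of Y 1] mono [of Y 2]
        digit_count_three_windows [of W X] digit_count_three_windows [of W Y] n_W
      unfolding n_def by (simp add: eval_nat_numeral add.assoc) linarith
  qed
  then show thesis using that [of "10 ^ (8 * (q\<^sub>0 + 1))"] by blast
qed

section \<open>The two exponents\<close>

lemma factor_nth: "i + int k \<le> j \<Longrightarrow> factor a i j ! k = a (nat (i + int k))"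
  using nth_upto [of i k j] by (simp add: factor_def)

lemma length_factor: "length (factor a i j) = nat (j - i + 1)"
  by (simp add: factor_def)

lemma rdio_cond_champernowne:
  assumes "rdio_cond champernowne \<rho>"
  shows "\<rho> \<le> 1"
proof (rule ccontr)
  assume "\<not> \<rho> \<le> 1"
  then have \<rho>: "0 < \<rho> - 1" by simp
  have "(0::real) < 1 / 2" by simp
  then obtain r s t :: "nat \<Rightarrow> int" and \<delta> :: nat where
    rst: "\<And>n. -1 \<le> r n \<and> r n < s n \<and> s n < t n"
    and ge: "\<And>n. of_int (t n) \<ge> \<rho> * of_int (s n)"
    and lim: "filterlim (\<lambda>n. s n - r n) at_top sequentially"
    and close: "\<forall>\<^sub>F n in sequentially.
        close_words (1 / 2) \<delta> (factor champernowne (r n + 1) (r n + t n - s n))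
          (factor champernowne (s n + 1) (t n))"
    using assms unfolding rdio_cond_def by blast
  \<comment> \<open>\<open>y = s n + 1 + u\<close> is at most \<open>K * L\<close>: the first term
    costs \<open>L / (\<rho> - 1)\<close>, the other two at most \<open>L\<close> each. The common
    run has length at least \<open>L / (2 * (\<delta> + 1))\<close>, which gives \<eta>.\<close>
  define K where "K = 2 + 1 / (\<rho> - 1)"
  define \<eta> where "\<eta> = 1 / (2 * real (\<delta> + 1) * K)"
  have K: "2 < K" using \<rho> by (simp add: K_def)
  have "1 * 1 \<le> (2 * real (\<delta> + 1)) * K" using K by (intro mult_mono) auto
  then have \<eta>: "0 < \<eta>" "\<eta> \<le> 1" unfolding \<eta>_def using K by auto
  obtain y\<^sub>0 where y\<^sub>0: "\<And>x y M. x < y \<Longrightarrow> y\<^sub>0 \<le> y \<Longrightarrow> \<eta> * real y \<le> real M \<Longrightarrow>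
    \<exists>i<M. champernowne (x + i) \<noteq> champernowne (y + i)"
    using no_long_repetition [OF \<eta>] by metis
  have "\<forall>\<^sub>F n in sequentially. int y\<^sub>0 \<le> s n - r n"
    using lim by (simp add: filterlim_at_top)
  then obtain n where n: "int y\<^sub>0 \<le> s n - r n"
    and cl: "close_words (1 / 2) \<delta> (factor champernowne (r n + 1) (r n + t n - s n))
          (factor champernowne (s n + 1) (t n))"
    using eventually_conj [OF _ close] eventually_happens' by (metis (mono_tags, lifting) sequentially_bot)
  define L where "L = nat (t n - s n)"
  have L: "int L = t n - s n" "0 < L" using rst [of n] by (auto simp: L_def)
  obtain u M where uM: "u + M \<le> L" "(1 - 1 / 2) * real L \<le> real (\<delta> + 1) * real M"
    and eq: "\<And>i. i < M \<Longrightarrow> factor champernowne (r n + 1) (r n + t n - s n) ! (u + i)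
       = factor champernowne (s n + 1) (t n) ! (u + i)"
    using close_words_common_run [OF cl] by (auto simp: length_factor L_def)
  define x y where "x = nat (r n + 1) + u" and "y = nat (s n + 1) + u"
  have "\<exists>i<M. champernowne (x + i) \<noteq> champernowne (y + i)"
  proof (rule y\<^sub>0)
    \<comment> \<open>\<open>r n \<ge> -1\<close> gives \<open>s n + 1 \<ge> s n - r n\<close>,
      which is at least \<open>y\<^sub>0\<close>.\<close>
    show "x < y" "y\<^sub>0 \<le> y" using rst [of n] n by (auto simp: x_def y_def)
    have "(\<rho> - 1) * of_int (s n) \<le> real L"
    proof -
      have "real L = of_int (t n) - of_int (s n)" using L(1) by (metis of_int_diff of_int_of_nat_eq)
      then show ?thesis using ge [of n] by (simp add: algebra_simps)
    qed
    then have "of_int (s n) \<le> real L / (\<rho> - 1)" using \<rho> by (simp add: field_simps)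
    moreover have "real y = of_int (s n) + 1 + real u" using rst [of n] by (simp add: y_def)
    moreover have "real u \<le> real L" "1 \<le> real L" using uM L by auto
    ultimately have "real y \<le> K * real L" by (simp add: K_def algebra_simps)
    also have "real L \<le> 2 * (real (\<delta> + 1) * real M)" using uM(2) by simp
    then have "K * real L \<le> K * (2 * real (\<delta> + 1) * real M)"
      using K unfolding mult.assoc by (intro mult_left_mono) auto
    finally have "real y \<le> real M * (2 * real (\<delta> + 1) * K)" by (simp only: mult_ac)
    moreover have "0 < 2 * real (\<delta> + 1) * K" using K by simp
    ultimately have "real y / (2 * real (\<delta> + 1) * K) \<le> real M" by (simp only: pos_divide_le_eq)
    then show "\<eta> * real y \<le> real M" by (simp add: \<eta>_def)
  qed
  then obtain i where i: "i < M" "champernowne (x + i) \<noteq> champernowne (y + i)" by blast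
  have "int (u + i) < t n - s n" using i uM L by linarith
  moreover have "nat (r n + 1 + int (u + i)) = x + i" "nat (s n + 1 + int (u + i)) = y + i"
    using rst [of n] by (auto simp: x_def y_def)
  ultimately show False using eq [OF i(1)] i(2) by (simp add: factor_nth)
qed

text \<open>Equal words are close with \<delta> = 0, so the same sequences serve every
  \<epsilon>.\<close>

lemma dio_cond_imp_rdio_cond:
  assumes "dio_cond a \<rho>"
  shows "rdio_cond a \<rho>"
proof -
  obtain r s t :: "nat \<Rightarrow> int" where
    *: "\<And>n. -1 \<le> r n \<and> r n < s n \<and> s n < t n \<and>
          factor a (r n + 1) (r n + t n - s n) = factor a (s n + 1) (t n) \<and>
          of_int (t n) \<ge> \<rho> * of_int (s n)"
    and "filterlim (\<lambda>n. s n - r n) at_top sequentially"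
    using assms unfolding dio_cond_def by blast
  moreover have "close_words \<epsilon> 0 (factor a (r n + 1) (r n + t n - s n)) (factor a (s n + 1) (t n))"
    if "0 < \<epsilon>" for \<epsilon> n
    using that * [of n] by (simp add: close_words_def length_factor)
  ultimately show ?thesis unfolding rdio_cond_def by (metis (mono_tags, lifting) always_eventually)
qed

text \<open>For exponent 1 a single letter is enough: the initial 1 recurs as the units digit of 11,
  21, 31, and so on. Thus \<open>r = -1\<close> and \<open>t = s + 1\<close>.\<close>

lemma dio_cond_champernowne: "dio_cond champernowne 1"
proof -
  define k where "k n = 10 * (n + 1) + 1" for n :: nat
  define e where "e n = start (k n) + (digit_count (k n) - 1)" for n
  have "champernowne (e n) = k n mod 10" for n
    using champernowne_read [of "k n" "digit_count (k n)" 0 "digit_count (k n) - 1"]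
      digit_count_pos [of "k n"] by (simp add: e_def k_def)
  then have e: "champernowne (e n) = 1" for n by (simp add: k_def)
  have c0: "champernowne 0 = 1"
    using champernowne_start [of 1 0] digit_count_pos [of 1] by (simp add: decimal_digits.simps)
  have large: "n < e n" for n
    using start_add_le [of 1 "k n - 1"] by (simp add: e_def k_def)
  have "filterlim (\<lambda>n. int (e n) - 1 - (-1)) at_top sequentially"
    unfolding filterlim_at_top eventually_sequentially
  proof (intro allI)
    fix Z :: int
    have "Z \<le> int (e n) - 1 - (-1)" if "nat Z \<le> n" for n using that large [of n] by linarith
    then show "\<exists>N. \<forall>n\<ge>N. Z \<le> int (e n) - 1 - (-1)" by blast
  qed
  moreover have "-1 < int (e n) - 1" for n using large [of n] by simp
  moreover have "factor champernowne (- 1 + 1) (- 1 + int (e n) - (int (e n) - 1))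
      = factor champernowne (int (e n) - 1 + 1) (int (e n))" for n
    using e [of n] c0 by (simp add: factor_def)
  ultimately show ?thesis
    unfolding dio_cond_def
    by (intro exI [of _ "\<lambda>n. -1"] exI [of _ "\<lambda>n. int (e n) - 1"] exI [of _ "\<lambda>n. int (e n)"])
      simp
qed

theorem theorem5p1: "Rdio champernowne = Dio champernowne \<and> Dio champernowne = 1"
proof -
  have "Rdio champernowne \<le> 1"
    unfolding Rdio_def by (rule SUP_least) (use rdio_cond_champernowne in \<open>auto simp: one_ereal_def\<close>)
  moreover have "Dio champernowne \<le> 1"
    unfolding Dio_def
    by (rule SUP_least) (use rdio_cond_champernowne dio_cond_imp_rdio_cond in \<open>auto simp: one_ereal_def\<close>)
  moreover have "1 \<le> Dio champernowne"
    unfolding Dio_def one_ereal_def by (rule SUP_upper) (use dio_cond_champernowne in auto)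
  moreover have "1 \<le> Rdio champernowne"
    unfolding Rdio_def one_ereal_def
    by (rule SUP_upper) (use dio_cond_champernowne dio_cond_imp_rdio_cond in auto)
  ultimately show ?thesis by auto
qed

end
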